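(* Let $X$ be a real Hilbert space and let $A,B$ be nonempty closed convex subsets of $X$. Let $\{A_n\}$ and $\{B_n\}$ be two sequences of nonempty closed convex subsets of $X$ such that $A_n\to A$ and $B_n\to B$ for the Attouch-Wets convergence. Suppose that there exist $y\in A\cap B$ and a continuous linear functional $f\in X^*$ with $\|f\|=1$ such that $\inf f(B)=f(y)=\sup f(A)$ and such that $f$ strongly exposes $A$ at $y$. Then, for each $a_0\in X$, the corresponding perturbed alternating projections sequences $\{a_n\}$ and $\{b_n\}$ (with respect to $\{A_n\}$ and $\{B_n\}$ and with starting point $a_0$) converge to $y$ in norm.
   Context: For a nonempty closed convex set $K\subset X$, $P_K$ denotes the metric projection onto $K$. Perturbed alternating projections sequences: given $a_0\in X$ and sequences $\{A_n\},\{B_n\}$ of nonempty closed convex sets, they are defined inductively by $b_n=P_{B_n}(a_{n-1})$ and $a_n=P_{A_n}(b_n)$ for $n\in\mathbb{N}=\{1,2,\dots\}$. Attouch-Wets convergence: let $B_X$ be the closed unit ball. For nonempty closed $A,C\subset X$ and $N\in\mathbb{N}$ put $e_N(A,C)=\sup\{\mathrm{dist}(a,C): a\in A,\ \|a\|\le N\}$ (equal to $0$ if $A\cap NB_X=\emptyset$) and $h_N(A,C)=\max\{e_N(A,C),e_N(C,A)\}$. A sequence $\{A_n\}$ of nonempty closed sets Attouch-Wets converges to the nonempty closed set $A$ if $\lim_n h_N(A_n,A)=0$ for every $N\in\mathbb{N}$. A functional $f\in X^*\setminus\{0\}$ strongly exposes a set $A$ at $a\in A$ if $f(a)=\sup f(A)$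 and $x_n\to a$ in norm for every sequence $\{x_n\}$ in $A$ with $\lim_n f(x_n)=\sup f(A)$. *)

theory Defs
  imports "HOL-Analysis.Analysis"
begin

text \<open>
  The library's \<^const>\<open>closest_point\<close> requires class \<^class>\<open>heine_borel\<close> and hence is not
  available in infinite dimension.  For a nonempty closed convex subset of a Hilbert
  space the point described here exists and is unique.
\<close>

definition metric_projection :: "'a::metric_space set \<Rightarrow> 'a \<Rightarrow> 'a" where
  "metric_projection K x = (THE p. p \<in> K \<and> (\<forall>z\<in>K. dist x p \<le> dist x z))"

text \<open>
  The index set is \<open>{1, 2, \<dots>}\<close>; the values \<open>A 0\<close>, \<open>B 0\<close> and \<open>b 0\<close> play no role.
\<close>

definition perturbed_alternating_projections ::
    "(nat \<Rightarrow> 'a::metric_space set) \<Rightarrow> (nat \<Rightarrow> 'a set) \<Rightarrow> 'a \<Rightarrow> (nat \<Rightarrow> 'a) \<Rightarrow> (nat \<Rightarrow> 'a) \<Rightarrow> bool" where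
  "perturbed_alternating_projections A B a0 a b \<longleftrightarrow>
     a 0 = a0 \<and>
     (\<forall>n\<ge>1. b n = metric_projection (B n) (a (n - 1)) \<and>
             a n = metric_projection (A n) (b n))"

text \<open>
  For \<open>C \<noteq> {}\<close> the supremum is over a set of reals bounded by \<open>N + infdist 0 C\<close>.
\<close>

definition aw_excess :: "nat \<Rightarrow> 'a::real_normed_vector set \<Rightarrow> 'a set \<Rightarrow> real" where
  "aw_excess N A C =
     (if A \<inter> cball 0 (real N) = {} then 0
      else (SUP x\<in>A \<inter> cball 0 (real N). infdist x C))"

definition aw_dist :: "nat \<Rightarrow> 'a::real_normed_vector set \<Rightarrow> 'a set \<Rightarrow> real" where
  "aw_dist N A C = max (aw_excess N A C) (aw_excess N C A)"

definition attouch_wets_converges ::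
    "(nat \<Rightarrow> 'a::real_normed_vector set) \<Rightarrow> 'a set \<Rightarrow> bool" where
  "attouch_wets_converges A L \<longleftrightarrow> (\<forall>N\<ge>1. (\<lambda>n. aw_dist N (A n) L) \<longlonglongrightarrow> 0)"

text \<open>
  Suprema are taken in \<^typ>\<open>ereal\<close>, because on \<^typ>\<open>real\<close> the supremum of an unbounded set
  is an unspecified real number.
\<close>

definition strongly_exposes ::
    "('a::real_normed_vector \<Rightarrow>\<^sub>L real) \<Rightarrow> 'a set \<Rightarrow> 'a \<Rightarrow> bool" where
  "strongly_exposes f A a \<longleftrightarrow>
     f \<noteq> 0 \<and> a \<in> A \<and> ereal (blinfun_apply f a) = (SUP x\<in>A. ereal (blinfun_apply f x)) \<and>
     (\<forall>x :: nat \<Rightarrow> 'a. (\<forall>n. x n \<in> A) \<longrightarrow>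
        (\<lambda>n. ereal (blinfun_apply f (x n))) \<longlonglongrightarrow> (SUP z\<in>A. ereal (blinfun_apply f z)) \<longrightarrow>
        x \<longlonglongrightarrow> a)"

end

theory Submission
  imports Defs
begin

text \<open>
  Write \<open>\<alpha>\<close> for the distance of \<open>a n\<close> to \<open>y\<close> and \<open>\<alpha>'\<close> for that of \<open>a (n - 1)\<close>.
  The idea is that a step of the perturbed scheme contracts the distance to \<open>y\<close> by a fixed factor,
  up to a small error, as long as \<open>\<alpha>\<close> is at least a given \<open>r > 0\<close>.

  Strong exposition and convexity put the part of \<open>A\<close> outside the ball of radius \<open>r\<close> around \<open>y\<close>
  into a cone \<open>f x - f y \<le> - \<delta> * norm (x - y)\<close> with \<open>\<delta> > 0\<close>, and \<open>f \<ge> f y\<close> on \<open>B\<close>.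
  Attouch-Wets convergence controls only bounded parts of the sets, but the points of \<open>An n\<close> and
  \<open>Bn n\<close> near \<open>y\<close> together with convexity propagate the bounds on bounded parts linearly to all of
  \<open>An n\<close> and \<open>Bn n\<close> outside a ball around \<open>y\<close>; for \<open>Bn n\<close> this reads
  \<open>f x - f y \<ge> - \<eta> * norm (x - y)\<close> with \<open>\<eta> > 0\<close> as small as desired
  (\<open>attouch_wets_linear_bound\<close>, \<open>strongly_exposes_attouch_wets_cone\<close>).  Hence, if \<open>\<alpha> \<ge> r\<close>, then
  \<open>norm (b n - a n) \<ge> \<kappa> * \<alpha>\<close> with \<open>\<kappa> = \<delta> / 2\<close>: either \<open>b n\<close> is more than twice as far from \<open>y\<close> as
  \<open>a n\<close>, or the values of \<open>f\<close> at the two points differ by that much (\<open>cone_separation\<close>).  The projection inequality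
  \<open>norm (p - z)\<^sup>2 + norm (x - p)\<^sup>2 \<le> norm (x - z)\<^sup>2\<close>, used with points \<open>z\<close> of \<open>An n\<close> and \<open>Bn n\<close>
  within \<open>\<epsilon>\<close> of \<open>y\<close>, turns this gap into \<open>\<alpha> \<le> q * \<alpha>' + 4 * \<epsilon>\<close>, where
  \<open>q = 1 / sqrt (1 + \<kappa>\<^sup>2) < 1\<close> is independent of \<open>\<epsilon>\<close> (\<open>projection_step_contracts\<close>).
  Choosing \<open>\<epsilon>\<close> after \<open>q\<close> shows that the excess of \<open>\<alpha>\<close> over \<open>r\<close> decays geometrically.  No
  separate proof that the sequences are bounded is needed, and \<open>b\<close> follows \<open>a\<close> because
  \<open>norm (b n - y) \<le> \<alpha>' + 2 * \<epsilon>\<close>.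
\<close>

section \<open>Metric projections in Hilbert space\<close>

lemma nearest_point_exists:
  fixes K :: "'a::{real_inner, complete_space} set"
  assumes "K \<noteq> {}" "closed K" "convex K"
  shows "\<exists>p\<in>K. \<forall>z\<in>K. dist x p \<le> dist x z"
proof -
  define d where "d = infdist x K"
  define S where "S n = K \<inter> cball x (d + 1 / real (Suc n))" for n
  have d0: "0 \<le> d" and dle: "\<And>z. z \<in> K \<Longrightarrow> d \<le> dist x z"
    unfolding d_def by (simp_all add: infdist_nonneg infdist_le)
  have cl: "closed (S n)" for n
    unfolding S_def using assms by (simp add: closed_Int)
  have ne: "S n \<noteq> {}" for n
  proof -
    have "(INF z\<in>K. dist x z) < d + 1 / real (Suc n)"
      using assms(1) by (simp add: d_def infdist_notempty)
    then obtain z where "z \<in> K" "dist x z < d + 1 / real (Suc n)"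
      using assms(1) cINF_less_iff[OF assms(1) bdd_below_image_dist] by blast
    then show ?thesis unfolding S_def by (auto intro: less_imp_le)
  qed
  have dec: "S n \<subseteq> S m" if "m \<le> n" for m n
  proof -
    have "1 / real (Suc n) \<le> 1 / real (Suc m)" using that by (simp add: frac_le)
    then show ?thesis unfolding S_def by auto
  qed
  \<comment> \<open>By the parallelogram law, the midpoint of two nearly nearest points being at distance at
      least \<open>d\<close> forces these points to be close to each other.\<close>
  have par: "(dist z w)\<^sup>2 \<le> (8 * d + 4) * e"
    if "z \<in> K" "w \<in> K" "dist x z \<le> d + e" "dist x w \<le> d + e" "0 < e" "e \<le> 1" for z w e
  proof -
    define m where "m = midpoint z w"
    have "m \<in> K"
      using convexD[OF assms(3) that(1,2), of "1/2" "1/2"]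
      unfolding m_def midpoint_def by (simp add: scaleR_add_right)
    then have "d\<^sup>2 \<le> (dist x m)\<^sup>2" using dle d0 by (simp add: power_mono)
    moreover have "(dist z w)\<^sup>2 = 2 * (dist x z)\<^sup>2 + 2 * (dist x w)\<^sup>2 - 4 * (dist x m)\<^sup>2"
      unfolding m_def midpoint_def dist_norm power2_norm_eq_inner
      by (simp add: algebra_simps inner_commute)
    moreover have "(dist x z)\<^sup>2 \<le> (d + e)\<^sup>2" "(dist x w)\<^sup>2 \<le> (d + e)\<^sup>2"
      using that by (simp_all add: power_mono)
    moreover have "e * e \<le> e" using that by (simp add: mult_left_le)
    ultimately show ?thesis by (simp add: power2_eq_square algebra_simps)
  qed
  have small: "\<exists>n. \<forall>z\<in>S n. \<forall>w\<in>S n. dist z w < e" if "e > 0" for e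
  proof -
    obtain n where "(8 * d + 4) / e\<^sup>2 < real n" using reals_Archimedean2 by blast
    then have "(8 * d + 4) / e\<^sup>2 < real (Suc n)" by simp
    then have n': "(8 * d + 4) * (1 / real (Suc n)) < e\<^sup>2"
      using that by (simp add: field_simps)
    have "dist z w < e" if "z \<in> S n" "w \<in> S n" for z w
    proof -
      have "(dist z w)\<^sup>2 \<le> (8 * d + 4) * (1 / real (Suc n))"
        by (rule par) (use that in \<open>auto simp: S_def\<close>)
      with n' have "(dist z w)\<^sup>2 < e\<^sup>2" by linarith
      then show ?thesis using \<open>e > 0\<close> by (simp add: power2_less_imp_less)
    qed
    then show ?thesis by blast
  qed
  obtain p where p: "\<And>n. p \<in> S n"
    using decreasing_closed_nest[of S, OF cl ne dec small] by blast
  have "dist x p \<le> d"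
  proof (rule field_le_epsilon)
    fix e :: real assume "0 < e"
    then obtain n where "1 / real (Suc n) < e" using nat_approx_posE by blast
    with p[of n] show "dist x p \<le> d + e" unfolding S_def by auto
  qed
  then have "\<forall>z\<in>K. dist x p \<le> dist x z" using dle by (meson order_trans)
  moreover have "p \<in> K" using p[of 0] unfolding S_def by simp
  ultimately show ?thesis by blast
qed

lemma metric_projection_nearest:
  fixes K :: "'a::{real_inner, complete_space} set"
  assumes "K \<noteq> {}" "closed K" "convex K"
  shows "metric_projection K x \<in> K" "\<forall>z\<in>K. dist x (metric_projection K x) \<le> dist x z"
proof -
  have "\<exists>!p. p \<in> K \<and> (\<forall>z\<in>K. dist x p \<le> dist x z)"
    using nearest_point_exists[OF assms, of x] any_closest_point_unique[OF assms(3,2)] by blast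
  from theI'[OF this] show "metric_projection K x \<in> K"
    "\<forall>z\<in>K. dist x (metric_projection K x) \<le> dist x z"
    unfolding metric_projection_def by blast+
qed

lemma metric_projection_pythagoras:
  fixes K :: "'a::{real_inner, complete_space} set"
  assumes "K \<noteq> {}" "closed K" "convex K" "z \<in> K"
  shows "(norm (metric_projection K x - z))\<^sup>2 + (norm (x - metric_projection K x))\<^sup>2
           \<le> (norm (x - z))\<^sup>2"
proof -
  let ?p = "metric_projection K x"
  have "inner (x - ?p) (z - ?p) \<le> 0"
    using any_closest_point_dot[OF assms(3,2) _ assms(4)] metric_projection_nearest[OF assms(1-3)]
    by blast
  then show ?thesis
    unfolding power2_norm_eq_inner by (simp add: algebra_simps inner_commute)
qed

section \<open>Attouch-Wets convergence\<close>

lemma infdist_le_aw_excess: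
  assumes "x \<in> S" "norm x \<le> real N"
  shows "infdist x T \<le> aw_excess N S T"
proof -
  have mem: "x \<in> S \<inter> cball 0 (real N)" using assms by simp
  have "infdist z T \<le> infdist 0 T + real N" if "z \<in> S \<inter> cball 0 (real N)" for z
    using infdist_triangle[of z T 0] that by simp
  then have "bdd_above ((\<lambda>z. infdist z T) ` (S \<inter> cball 0 (real N)))"
    by (rule bdd_aboveI2)
  from cSUP_upper[OF mem this] show ?thesis
    using mem unfolding aw_excess_def by auto
qed

lemma infdist_less_obtain:
  fixes T :: "'a::metric_space set"
  assumes "infdist x T < e" "T \<noteq> {}"
  obtains z where "z \<in> T" "dist x z < e"
  using assms cINF_less_iff[OF assms(2) bdd_below_image_dist, of x e]
  by (auto simp: infdist_notempty)

text \<open>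
  The bound \<open>R\<close> is an arbitrary real, while the definition uses balls of positive integer radius.
\<close>

lemma attouch_wets_eventually_close:
  fixes C :: "'a::real_normed_vector set"
  assumes "attouch_wets_converges Cn C" "C \<noteq> {}" "\<forall>n\<ge>1. Cn n \<noteq> {}" "e > 0"
  shows "eventually (\<lambda>n. (\<forall>x\<in>Cn n. norm x \<le> R \<longrightarrow> (\<exists>z\<in>C. dist x z < e)) \<and>
                         (\<forall>x\<in>C. norm x \<le> R \<longrightarrow> (\<exists>z\<in>Cn n. dist x z < e))) sequentially"
proof -
  obtain N :: nat where N: "R \<le> real N" "N \<ge> 1"
    using real_arch_simple[of "max R 1"] by auto
  have "eventually (\<lambda>n. aw_dist N (Cn n) C < e) sequentially"
    using assms(1,4) N(2) unfolding attouch_wets_converges_def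
    by (auto intro: order_tendstoD(2))
  then show ?thesis
    using eventually_ge_at_top[of 1]
  proof eventually_elim
    case (elim n)
    have "\<exists>z\<in>C. dist x z < e" if "x \<in> Cn n" "norm x \<le> R" for x
    proof -
      have "infdist x C < e"
        using infdist_le_aw_excess[OF that(1), of N C] that(2) N elim(1)
        unfolding aw_dist_def by auto
      then show ?thesis using infdist_less_obtain assms(2) by blast
    qed
    moreover have "\<exists>z\<in>Cn n. dist x z < e" if "x \<in> C" "norm x \<le> R" for x
    proof -
      have "infdist x (Cn n) < e"
        using infdist_le_aw_excess[OF that(1), of N "Cn n"] that(2) N elim(1)
        unfolding aw_dist_def by auto
      then show ?thesis using infdist_less_obtain assms(3) elim(2) by blast
    qed
    ultimately show ?case by blast
  qed
qed

lemma blinfun_le_norm_diff: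
  fixes f :: "'a::real_normed_vector \<Rightarrow>\<^sub>L real"
  assumes "norm f \<le> 1"
  shows "blinfun_apply f x - blinfun_apply f z \<le> norm (x - z)"
proof -
  have "\<bar>blinfun_apply f (x - z)\<bar> \<le> norm f * norm (x - z)"
    using norm_blinfun[of f "x - z"] by simp
  also have "\<dots> \<le> norm (x - z)"
    using assms by (simp add: mult_left_le_one_le)
  finally show ?thesis by (simp add: blinfun.diff_right)
qed

text \<open>
  A bound for \<open>f\<close> on the part of the limit set away from \<open>y\<close> becomes a linear bound on the whole
  unbounded part of \<open>Cn n\<close> away from \<open>y\<close>: the segment from a point of \<open>Cn n\<close> near \<open>y\<close> to \<open>x\<close> meets
  the region where \<open>Cn n\<close> is close to \<open>C\<close>.
\<close>

lemma attouch_wets_linear_bound: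
  fixes f :: "'a::real_normed_vector \<Rightarrow>\<^sub>L real"
  assumes "attouch_wets_converges Cn C" "y \<in> C"
    and "\<forall>n\<ge>1. Cn n \<noteq> {}" "\<forall>n\<ge>1. convex (Cn n)"
    and "norm f \<le> 1" "0 < r" "0 < e"
    and m: "\<And>z. z \<in> C \<Longrightarrow> norm (z - y) \<ge> r / 2 \<Longrightarrow> blinfun_apply f z \<le> blinfun_apply f y - m"
  shows "eventually (\<lambda>n. \<forall>x\<in>Cn n. norm (x - y) \<ge> r \<longrightarrow>
           blinfun_apply f x - blinfun_apply f y \<le> (e - m) / r * norm (x - y)) sequentially"
proof -
  define \<epsilon> where "\<epsilon> = min (r / 4) (e / 2)"
  have \<epsilon>: "0 < \<epsilon>" "\<epsilon> \<le> r / 4" "2 * \<epsilon> \<le> e"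
    using assms(6,7) unfolding \<epsilon>_def by auto
  define R where "R = norm y + 2 * r"
  have yR: "norm y \<le> R" using assms(6) unfolding R_def by simp
  have "C \<noteq> {}" using assms(2) by blast
  from attouch_wets_eventually_close[OF assms(1) this assms(3) \<epsilon>(1), of R]
  show ?thesis using eventually_ge_at_top[of 1]
  proof eventually_elim
    case (elim n)
    obtain c where c: "c \<in> Cn n" "norm (c - y) < \<epsilon>"
      using elim(1) assms(2) yR by (metis dist_commute dist_norm)
    show ?case
    proof (intro ballI impI)
      fix x assume x: "x \<in> Cn n" "r \<le> norm (x - y)"
      \<comment> \<open>The point \<open>w\<close> of the segment lies at distance about \<open>r\<close> from \<open>y\<close>, so it is close to a point
          of \<open>C\<close> at distance at least \<open>r / 2\<close> from \<open>y\<close>.\<close>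
      define t where "t = r / norm (x - y)"
      have t: "0 < t" "t \<le> 1" "t * norm (x - y) = r"
        using x(2) assms(6) less_le_trans[OF assms(6) x(2)] unfolding t_def by simp_all
      define w where "w = (1 - t) *\<^sub>R c + t *\<^sub>R x"
      have w: "w \<in> Cn n"
        using convexD_alt[OF assms(4)[rule_format, OF elim(2)] c(1) x(1), of t] t unfolding w_def by simp
      have wy: "w - y = (1 - t) *\<^sub>R (c - y) + t *\<^sub>R (x - y)"
        unfolding w_def by (simp add: algebra_simps)
      have small: "norm ((1 - t) *\<^sub>R (c - y)) \<le> \<epsilon>"
        using c(2) t mult_mono[of "1 - t" 1 "norm (c - y)" \<epsilon>] by simp
      have big: "norm (t *\<^sub>R (x - y)) = r" using t by simp
      have "norm (w - y) \<le> r + \<epsilon>"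
        using norm_triangle_ineq[of "(1 - t) *\<^sub>R (c - y)" "t *\<^sub>R (x - y)"] small big wy by simp
      then have "norm w \<le> R"
        using norm_triangle_ineq[of y "w - y"] \<epsilon> assms(6) unfolding R_def by simp
      then obtain z where z: "z \<in> C" "norm (w - z) < \<epsilon>"
        using elim(1) w by (metis dist_norm)
      have "norm (w - y) \<ge> r - \<epsilon>"
        using norm_triangle_ineq2[of "t *\<^sub>R (x - y)" "- ((1 - t) *\<^sub>R (c - y))"] small big wy
        by (simp add: add.commute)
      then have "norm (z - y) \<ge> r / 2"
        using norm_triangle_ineq[of "w - z" "z - y"] z(2) \<epsilon>(2) by simp
      with m[OF z(1)] have fz: "blinfun_apply f z \<le> blinfun_apply f y - m" by blast
      have "blinfun_apply f (w - y)
              = (1 - t) * blinfun_apply f (c - y) + t * blinfun_apply f (x - y)"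
        unfolding wy by (simp add: blinfun.add_right blinfun.scaleR_right)
      moreover have "(1 - t) * blinfun_apply f (c - y) \<ge> - \<epsilon>"
        using blinfun_le_norm_diff[OF assms(5), of 0 "(1 - t) *\<^sub>R (c - y)"] small
        by (simp add: blinfun.scaleR_right)
      moreover have "blinfun_apply f w \<le> blinfun_apply f z + \<epsilon>"
        using blinfun_le_norm_diff[OF assms(5), of w z] z(2) by simp
      ultimately have "t * (blinfun_apply f x - blinfun_apply f y) \<le> e - m"
        using fz \<epsilon>(3) by (simp add: blinfun.diff_right)
      then have "t * norm (x - y) * (blinfun_apply f x - blinfun_apply f y) \<le> (e - m) * norm (x - y)"
        using mult_right_mono[OF _ norm_ge_zero, of _ _ "x - y"] by (fastforce simp: mult_ac)
      then have "r * (blinfun_apply f x - blinfun_apply f y) \<le> (e - m) * norm (x - y)"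
        unfolding t(3) .
      then show "blinfun_apply f x - blinfun_apply f y \<le> (e - m) / r * norm (x - y)"
        using assms(6) by (simp add: field_simps)
    qed
  qed
qed

section \<open>Strong exposition\<close>

lemma strongly_exposes_gap:
  fixes f :: "'a::real_normed_vector \<Rightarrow>\<^sub>L real"
  assumes "strongly_exposes f A y" "r > 0"
  obtains m where "m > 0"
    "\<And>z. z \<in> A \<Longrightarrow> norm (z - y) \<ge> r \<Longrightarrow> blinfun_apply f z \<le> blinfun_apply f y - m"
proof -
  have sup: "(SUP z\<in>A. ereal (blinfun_apply f z)) = ereal (blinfun_apply f y)"
    and conv: "\<And>x. (\<And>n. x n \<in> A) \<Longrightarrow>
      (\<lambda>n. ereal (blinfun_apply f (x n))) \<longlonglongrightarrow> (SUP z\<in>A. ereal (blinfun_apply f z)) \<Longrightarrow> x \<longlonglongrightarrow> y"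
    using assms(1) unfolding strongly_exposes_def by auto
  have le: "blinfun_apply f z \<le> blinfun_apply f y" if "z \<in> A" for z
    using SUP_upper[OF that, of "\<lambda>z. ereal (blinfun_apply f z)"] sup by simp
  have "\<exists>m>0. \<forall>z\<in>A. norm (z - y) \<ge> r \<longrightarrow> blinfun_apply f z \<le> blinfun_apply f y - m"
  proof (rule ccontr)
    assume "\<not> ?thesis"
    then have "\<forall>n. \<exists>z. z \<in> A \<and> norm (z - y) \<ge> r \<and>
        blinfun_apply f z > blinfun_apply f y - 1 / real (Suc n)"
      using zero_less_divide_1_iff of_nat_0_less_iff zero_less_Suc by (meson not_le)
    then obtain x where x: "\<And>n. x n \<in> A" "\<And>n. norm (x n - y) \<ge> r"
        "\<And>n. blinfun_apply f (x n) > blinfun_apply f y - 1 / real (Suc n)"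
      by metis
    have "(\<lambda>n. blinfun_apply f (x n)) \<longlonglongrightarrow> blinfun_apply f y"
    proof (rule tendsto_sandwich[OF _ _ _ tendsto_const])
      show "(\<lambda>n. blinfun_apply f y - 1 / real (Suc n)) \<longlonglongrightarrow> blinfun_apply f y"
        using tendsto_diff[OF tendsto_const LIMSEQ_inverse_real_of_nat, of "blinfun_apply f y"]
        by (simp add: inverse_eq_divide)
    qed (use x le in \<open>auto intro!: always_eventually less_imp_le\<close>)
    then have "x \<longlonglongrightarrow> y" using conv x(1) sup by simp
    then have "eventually (\<lambda>n. dist (x n) y < r) sequentially"
      using assms(2) by (rule tendstoD)
    then show False using x(2) by (auto simp: dist_norm not_less[symmetric] eventually_sequentially)
  qed
  then show thesis using that by blast
qed

text \<open>
  The constant \<open>\<delta>\<close> is asked to be at most \<open>1\<close> because it is compared with the trivial gap in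
  \<open>cone_separation\<close>.
\<close>

lemma strongly_exposes_attouch_wets_cone:
  fixes f :: "'a::real_normed_vector \<Rightarrow>\<^sub>L real"
  assumes "strongly_exposes f A y" "attouch_wets_converges An A"
    and "\<forall>n\<ge>1. An n \<noteq> {}" "\<forall>n\<ge>1. convex (An n)"
    and "norm f \<le> 1" "0 < r"
  obtains \<delta> where "0 < \<delta>" "\<delta> \<le> 1"
    "eventually (\<lambda>n. \<forall>x\<in>An n. norm (x - y) \<ge> r \<longrightarrow>
       blinfun_apply f x - blinfun_apply f y \<le> - \<delta> * norm (x - y)) sequentially"
proof -
  have y: "y \<in> A" using assms(1) unfolding strongly_exposes_def by blast
  obtain m where m: "m > 0"
    "\<And>z. z \<in> A \<Longrightarrow> norm (z - y) \<ge> r / 2 \<Longrightarrow> blinfun_apply f z \<le> blinfun_apply f y - m"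
    using strongly_exposes_gap[OF assms(1), of "r / 2"] assms(6) by auto
  define \<delta> where "\<delta> = min 1 (m / 2 / r)"
  have \<delta>: "0 < \<delta>" "\<delta> \<le> 1" "(m / 2 - m) / r \<le> - \<delta>"
    using m(1) assms(6) unfolding \<delta>_def by (auto simp: field_simps min_def)
  have m2: "0 < m / 2" using m(1) by simp
  have "eventually (\<lambda>n. \<forall>x\<in>An n. norm (x - y) \<ge> r \<longrightarrow>
       blinfun_apply f x - blinfun_apply f y \<le> (m / 2 - m) / r * norm (x - y)) sequentially"
    by (rule attouch_wets_linear_bound[OF assms(2) y assms(3-6) m2 m(2)])
  then have "eventually (\<lambda>n. \<forall>x\<in>An n. norm (x - y) \<ge> r \<longrightarrow>
       blinfun_apply f x - blinfun_apply f y \<le> - \<delta> * norm (x - y)) sequentially"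
  proof eventually_elim
    case (elim n)
    then show ?case using mult_right_mono[OF \<delta>(3) norm_ge_zero] by (meson order_trans)
  qed
  with \<delta> that show thesis by blast
qed

section \<open>One step of the perturbed scheme\<close>

lemma cone_separation:
  fixes f :: "'a::real_normed_vector \<Rightarrow>\<^sub>L real"
  assumes "norm f \<le> 1" "0 < \<delta>" "\<delta> \<le> 1"
    and "blinfun_apply f u - blinfun_apply f y \<le> - \<delta> * norm (u - y)"
    and "blinfun_apply f v - blinfun_apply f y \<ge> - (\<delta> / 4) * norm (v - y)"
  shows "\<delta> / 2 * norm (u - y) \<le> norm (v - u)"
proof (cases "norm (v - y) \<le> 2 * norm (u - y)")
  case True
  then have "\<delta> / 4 * norm (v - y) \<le> \<delta> / 4 * (2 * norm (u - y))"
    using assms(2) by (intro mult_left_mono) auto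
  then show ?thesis using assms(4,5) blinfun_le_norm_diff[OF assms(1), of v u] by simp
next
  case False
  then have "norm (u - y) \<le> norm (v - u)"
    using norm_triangle_ineq[of "v - u" "u - y"] by simp
  moreover have "\<delta> / 2 * norm (u - y) \<le> norm (u - y)"
    using assms(2,3) mult_right_mono[of "\<delta> / 2" 1 "norm (u - y)"] by simp
  ultimately show ?thesis by linarith
qed

text \<open>
  Here \<open>v\<close> and \<open>u\<close> are consecutive projections of \<open>x\<close>, and \<open>d\<close>, \<open>c\<close> are points near \<open>y\<close> of the
  sets that are projected onto.
\<close>

lemma projection_step_contracts:
  fixes x v u c d y :: "'a::real_inner"
  assumes "(norm (u - c))\<^sup>2 + (norm (v - u))\<^sup>2 \<le> (norm (v - c))\<^sup>2"
    and "(norm (v - d))\<^sup>2 + (norm (x - v))\<^sup>2 \<le> (norm (x - d))\<^sup>2"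
    and "norm (c - y) \<le> \<epsilon>" "norm (d - y) \<le> \<epsilon>"
    and gap: "\<kappa> * norm (u - y) \<le> norm (v - u)" and "0 \<le> \<kappa>" "\<epsilon> \<le> norm (u - y)"
  shows "norm (u - y) \<le> 1 / sqrt (1 + \<kappa>\<^sup>2) * norm (x - y) + 4 * \<epsilon>"
proof -
  define s where "s = sqrt (1 + \<kappa>\<^sup>2)"
  have s: "s \<ge> 1" "s\<^sup>2 = 1 + \<kappa>\<^sup>2" unfolding s_def by simp_all
  have \<epsilon>: "0 \<le> \<epsilon>" using assms(3) norm_ge_zero order_trans by blast
  have "(norm (v - d))\<^sup>2 \<le> (norm (x - d))\<^sup>2" using assms(2) zero_le_power2 [of "norm (x - v)"] by linarith
  then have "norm (v - d) \<le> norm (x - d)" by simp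
  moreover have "norm (v - y) \<le> norm (v - d) + norm (d - y)"
    using norm_triangle_ineq[of "v - d" "d - y"] by simp
  moreover have "norm (x - d) \<le> norm (x - y) + norm (d - y)"
    using norm_triangle_ineq4[of "x - y" "d - y"] by simp
  moreover have "norm (v - c) \<le> norm (v - y) + norm (c - y)"
    using norm_triangle_ineq4[of "v - y" "c - y"] by simp
  ultimately have vc: "norm (v - c) \<le> norm (x - y) + 3 * \<epsilon>" using assms(3,4) by linarith
  have uc: "norm (u - y) - \<epsilon> \<le> norm (u - c)"
    using norm_triangle_ineq[of "u - c" "c - y"] assms(3) by simp
  have "(s * (norm (u - y) - \<epsilon>))\<^sup>2 = (norm (u - y) - \<epsilon>)\<^sup>2 + (\<kappa> * (norm (u - y) - \<epsilon>))\<^sup>2"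
    unfolding power_mult_distrib s by (simp add: algebra_simps)
  also have "\<dots> \<le> (norm (u - c))\<^sup>2 + (norm (v - u))\<^sup>2"
  proof (intro add_mono power_mono)
    show "\<kappa> * (norm (u - y) - \<epsilon>) \<le> norm (v - u)"
      using gap mult_nonneg_nonneg[OF assms(6) \<epsilon>] by (simp add: right_diff_distrib)
  qed (use uc assms(6,7) in auto)
  also have "\<dots> \<le> (norm (v - c))\<^sup>2" by (rule assms(1))
  finally have "s * (norm (u - y) - \<epsilon>) \<le> norm (v - c)"
    by (rule power2_le_imp_le) simp
  with vc have "s * (norm (u - y) - \<epsilon>) \<le> norm (x - y) + 3 * \<epsilon>" by linarith
  then have "norm (u - y) - \<epsilon> \<le> (norm (x - y) + 3 * \<epsilon>) / s"
    using s(1) by (simp add: field_simps)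
  also have "\<dots> = 1 / s * norm (x - y) + 3 * \<epsilon> / s" by (simp add: add_divide_distrib)
  also have "3 * \<epsilon> / s \<le> 3 * \<epsilon>"
    using s(1) \<epsilon> by (simp add: divide_le_eq mult_left_le mult_le_cancel_left1)
  finally show ?thesis unfolding s_def by simp
qed

lemma eventually_less_of_contraction:
  fixes u :: "nat \<Rightarrow> real"
  assumes "eventually (\<lambda>n. u (Suc n) \<le> r \<or> u (Suc n) - r \<le> q * (u n - r)) sequentially"
    and "0 \<le> q" "q < 1" "r < s"
  shows "eventually (\<lambda>n. u n < s) sequentially"
proof -
  define w where "w n = max 0 (u n - r)" for n
  obtain N where N: "\<And>n. n \<ge> N \<Longrightarrow> u (Suc n) \<le> r \<or> u (Suc n) - r \<le> q * (u n - r)"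
    using assms(1) unfolding eventually_sequentially by blast
  have step: "w (Suc n) \<le> q * w n" if "n \<ge> N" for n
  proof -
    have "q * (u n - r) \<le> q * w n" "0 \<le> q * w n"
      using assms(2) unfolding w_def by (auto intro: mult_left_mono)
    with N[OF that] show ?thesis unfolding w_def by linarith
  qed
  have pow: "w (k + N) \<le> q ^ k * w N" for k
  proof (induction k)
    case (Suc k)
    have "w (Suc k + N) \<le> q * w (k + N)" using step[of "k + N"] by simp
    also have "\<dots> \<le> q * (q ^ k * w N)" using Suc assms(2) by (rule mult_left_mono)
    finally show ?case by simp
  qed simp
  have "(\<lambda>k. q ^ k * w N) \<longlonglongrightarrow> 0 * w N"
    using assms(2,3) by (intro tendsto_mult_right LIMSEQ_realpow_zero)
  then have "eventually (\<lambda>k. q ^ k * w N < s - r) sequentially"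
    using assms(4) by (intro order_tendstoD(2)[where y = "0 * w N"]) auto
  then have "eventually (\<lambda>k. u (k + N) < s) sequentially"
  proof eventually_elim
    case (elim k)
    with pow[of k] show ?case unfolding w_def by auto
  qed
  then show ?thesis by (rule eventually_sequentially_seg[THEN iffD1])
qed

section \<open>Convergence of the scheme\<close>

theorem theorem3p3:
  fixes A B :: "'a::{real_inner, complete_space} set"
    and An Bn :: "nat \<Rightarrow> 'a set"
    and f :: "'a \<Rightarrow>\<^sub>L real"
    and y a0 :: 'a
    and a b :: "nat \<Rightarrow> 'a"
  assumes "A \<noteq> {}" "closed A" "convex A"
    and "B \<noteq> {}" "closed B" "convex B"
    and "\<And>n. n \<ge> 1 \<Longrightarrow> An n \<noteq> {} \<and> closed (An n) \<and> convex (An n)"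
    and "\<And>n. n \<ge> 1 \<Longrightarrow> Bn n \<noteq> {} \<and> closed (Bn n) \<and> convex (Bn n)"
    and "attouch_wets_converges An A"
    and "attouch_wets_converges Bn B"
    and "y \<in> A \<inter> B"
    and "norm f = 1"
    and "(INF x\<in>B. ereal (blinfun_apply f x)) = ereal (blinfun_apply f y)"
    and "ereal (blinfun_apply f y) = (SUP x\<in>A. ereal (blinfun_apply f x))"
    and "strongly_exposes f A y"
    and "perturbed_alternating_projections An Bn a0 a b"
  shows "a \<longlonglongrightarrow> y \<and> b \<longlonglongrightarrow> y"
proof -
  have yA: "y \<in> A" and yB: "y \<in> B" and nf: "norm f \<le> 1" and nf': "norm (- f) \<le> 1"
    using assms(11,12) by auto
  have An: "An n \<noteq> {}" "closed (An n)" "convex (An n)"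
    and Bn: "Bn n \<noteq> {}" "closed (Bn n)" "convex (Bn n)" if "n \<ge> 1" for n
    using assms(7,8) that by blast+
  have An': "\<forall>n\<ge>1. An n \<noteq> {}" "\<forall>n\<ge>1. convex (An n)"
    and Bn': "\<forall>n\<ge>1. Bn n \<noteq> {}" "\<forall>n\<ge>1. convex (Bn n)"
    using An Bn by blast+
  have b_eq: "b (Suc n) = metric_projection (Bn (Suc n)) (a n)"
    and a_eq: "a (Suc n) = metric_projection (An (Suc n)) (b (Suc n))" for n
    using assms(16) unfolding perturbed_alternating_projections_def by auto
  have fB: "blinfun_apply f y \<le> blinfun_apply f z" if "z \<in> B" for z
    using INF_lower[OF that, of "\<lambda>z. ereal (blinfun_apply f z)"] assms(13) by simp
  have near: "eventually (\<lambda>n. (\<exists>c\<in>An n. norm (c - y) \<le> e) \<and> (\<exists>d\<in>Bn n. norm (d - y) \<le> e))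
      sequentially" if "e > 0" for e
    using attouch_wets_eventually_close[OF assms(9) assms(1) An'(1) that, of "norm y"]
      attouch_wets_eventually_close[OF assms(10) assms(4) Bn'(1) that, of "norm y"]
  proof eventually_elim
    case (elim n)
    obtain c d where "c \<in> An n" "dist y c < e" "d \<in> Bn n" "dist y d < e"
      using elim yA yB by blast
    then show ?case by (metis dist_commute dist_norm less_imp_le)
  qed
  have b_bound: "norm (b (Suc n) - y) \<le> norm (a n - y) + 2 * e"
    if "d \<in> Bn (Suc n)" "norm (d - y) \<le> e" for n d e
  proof -
    have "(norm (b (Suc n) - d))\<^sup>2 + (norm (a n - b (Suc n)))\<^sup>2 \<le> (norm (a n - d))\<^sup>2"
      using metric_projection_pythagoras[OF Bn[of "Suc n"] that(1), of "a n"] b_eq[of n] by simp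
    then have "(norm (b (Suc n) - d))\<^sup>2 \<le> (norm (a n - d))\<^sup>2"
      using zero_le_power2[of "norm (a n - b (Suc n))"] by linarith
    then have "norm (b (Suc n) - d) \<le> norm (a n - d)" by simp
    moreover have "norm (b (Suc n) - y) \<le> norm (b (Suc n) - d) + norm (d - y)"
      using norm_triangle_ineq[of "b (Suc n) - d" "d - y"] by simp
    moreover have "norm (a n - d) \<le> norm (a n - y) + norm (d - y)"
      using norm_triangle_ineq4[of "a n - y" "d - y"] by simp
    ultimately show ?thesis using that(2) by linarith
  qed
  have a_close: "eventually (\<lambda>n. norm (a n - y) < s) sequentially" if "s > 0" for s
  proof -
    define r where "r = s / 2"
    have r: "0 < r" "r < s" "0 < r / 2" using that unfolding r_def by auto
    obtain \<delta> where \<delta>: "0 < \<delta>" "\<delta> \<le> 1"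
      "eventually (\<lambda>n. \<forall>x\<in>An n. norm (x - y) \<ge> r \<longrightarrow>
         blinfun_apply f x - blinfun_apply f y \<le> - \<delta> * norm (x - y)) sequentially"
      using strongly_exposes_attouch_wets_cone[OF assms(15,9) An' nf r(1)] by blast
    \<comment> \<open>The radius for \<open>Bn\<close> is \<open>r / 2\<close>, since \<open>b n\<close> may be slightly closer to \<open>y\<close> than \<open>a n\<close>.\<close>
    have e0: "0 < \<delta> / 4 * (r / 2)" using \<delta> r by simp
    have "eventually (\<lambda>n. \<forall>x\<in>Bn n. norm (x - y) \<ge> r / 2 \<longrightarrow>
        blinfun_apply (- f) x - blinfun_apply (- f) y
          \<le> (\<delta> / 4 * (r / 2) - 0) / (r / 2) * norm (x - y)) sequentially"
      by (rule attouch_wets_linear_bound[OF assms(10) yB Bn' nf' r(3) e0])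
        (simp_all add: fB uminus_blinfun.rep_eq)
    then have evB: "eventually (\<lambda>n. \<forall>x\<in>Bn n. norm (x - y) \<ge> r / 2 \<longrightarrow>
        blinfun_apply f x - blinfun_apply f y \<ge> - (\<delta> / 4) * norm (x - y)) sequentially"
    proof eventually_elim
      case (elim n)
      have "- blinfun_apply f x + blinfun_apply f y \<le> \<delta> / 4 * norm (x - y)"
        if "x \<in> Bn n" "norm (x - y) \<ge> r / 2" for x
        using elim that r(1) by (simp add: uminus_blinfun.rep_eq)
      then show ?case by fastforce
    qed
    define q where "q = 1 / sqrt (1 + (\<delta> / 2)\<^sup>2)"
    have "1 < sqrt (1 + (\<delta> / 2)\<^sup>2)" using \<delta>(1) by simp
    then have q: "0 \<le> q" "q < 1" unfolding q_def by (simp, subst divide_less_eq_1_pos) linarith+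
    define \<epsilon> where "\<epsilon> = (1 - q) * r / 4"
    have \<epsilon>: "0 < \<epsilon>" "\<epsilon> \<le> r / 4" "4 * \<epsilon> = r - q * r"
      using q r(1) mult_nonneg_nonneg[OF q(1) less_imp_le[OF r(1)]]
      unfolding \<epsilon>_def by (simp_all add: left_diff_distrib)
    have "eventually (\<lambda>n. (\<forall>x\<in>An n. norm (x - y) \<ge> r \<longrightarrow>
         blinfun_apply f x - blinfun_apply f y \<le> - \<delta> * norm (x - y)) \<and>
        (\<forall>x\<in>Bn n. norm (x - y) \<ge> r / 2 \<longrightarrow>
        blinfun_apply f x - blinfun_apply f y \<ge> - (\<delta> / 4) * norm (x - y)) \<and>
        (\<exists>c\<in>An n. norm (c - y) \<le> \<epsilon>) \<and> (\<exists>d\<in>Bn n. norm (d - y) \<le> \<epsilon>)) sequentially"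
      using \<delta>(3) evB near[OF \<epsilon>(1)] by eventually_elim blast
    then have "eventually (\<lambda>n. (\<forall>x\<in>An (Suc n). norm (x - y) \<ge> r \<longrightarrow>
         blinfun_apply f x - blinfun_apply f y \<le> - \<delta> * norm (x - y)) \<and>
        (\<forall>x\<in>Bn (Suc n). norm (x - y) \<ge> r / 2 \<longrightarrow>
        blinfun_apply f x - blinfun_apply f y \<ge> - (\<delta> / 4) * norm (x - y)) \<and>
        (\<exists>c\<in>An (Suc n). norm (c - y) \<le> \<epsilon>) \<and> (\<exists>d\<in>Bn (Suc n). norm (d - y) \<le> \<epsilon>)) sequentially"
      by (rule eventually_sequentially_Suc[THEN iffD2])
    then have "eventually (\<lambda>n. norm (a (Suc n) - y) \<le> r \<or>
        norm (a (Suc n) - y) - r \<le> q * (norm (a n - y) - r)) sequentially"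
    proof eventually_elim
      case (elim n)
      obtain c d where c: "c \<in> An (Suc n)" "norm (c - y) \<le> \<epsilon>"
        and d: "d \<in> Bn (Suc n)" "norm (d - y) \<le> \<epsilon>"
        using elim by blast
      have aA: "a (Suc n) \<in> An (Suc n)" and bB: "b (Suc n) \<in> Bn (Suc n)"
        unfolding a_eq b_eq by (simp_all add: metric_projection_nearest(1) An Bn)
      have pa: "(norm (a (Suc n) - c))\<^sup>2 + (norm (b (Suc n) - a (Suc n)))\<^sup>2
          \<le> (norm (b (Suc n) - c))\<^sup>2"
        using metric_projection_pythagoras[OF An[of "Suc n"] c(1)] a_eq by simp
      have pb: "(norm (b (Suc n) - d))\<^sup>2 + (norm (a n - b (Suc n)))\<^sup>2 \<le> (norm (a n - d))\<^sup>2"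
        using metric_projection_pythagoras[OF Bn[of "Suc n"] d(1)] b_eq by simp
      show ?case
      proof (cases "norm (a (Suc n) - y) \<le> r")
        case False
        have "(norm (a (Suc n) - c))\<^sup>2 \<le> (norm (b (Suc n) - c))\<^sup>2"
          using pa zero_le_power2[of "norm (b (Suc n) - a (Suc n))"] by linarith
        then have "norm (a (Suc n) - c) \<le> norm (b (Suc n) - c)" by simp
        then have "r / 2 \<le> norm (b (Suc n) - y)"
          using norm_triangle_ineq[of "a (Suc n) - c" "c - y"]
            norm_triangle_ineq4[of "b (Suc n) - y" "c - y"] c(2) \<epsilon>(2) False by simp
        then have "blinfun_apply f (b (Suc n)) - blinfun_apply f y
            \<ge> - (\<delta> / 4) * norm (b (Suc n) - y)"
          using elim bB by blast
        moreover have "blinfun_apply f (a (Suc n)) - blinfun_apply f y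
            \<le> - \<delta> * norm (a (Suc n) - y)"
          using elim aA False by simp
        ultimately have "\<delta> / 2 * norm (a (Suc n) - y) \<le> norm (b (Suc n) - a (Suc n))"
          using cone_separation[OF nf \<delta>(1,2)] by blast
        from projection_step_contracts[OF pa pb c(2) d(2) this]
        have "norm (a (Suc n) - y) \<le> q * norm (a n - y) + 4 * \<epsilon>"
          using \<delta>(1) \<epsilon>(2) False r(1) unfolding q_def by simp
        then show ?thesis using \<epsilon>(3) by (simp add: algebra_simps)
      qed simp
    qed
    then show ?thesis by (rule eventually_less_of_contraction) (use q r in auto)
  qed
  have "a \<longlonglongrightarrow> y"
    by (rule tendstoI) (use a_close in \<open>simp add: dist_norm\<close>)
  moreover have "(\<lambda>n. b (Suc n)) \<longlonglongrightarrow> y"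
  proof (rule tendstoI)
    fix e :: real assume "0 < e"
    then have e3: "0 < e / 3" by simp
    have "eventually (\<lambda>n. \<exists>d\<in>Bn (Suc n). norm (d - y) \<le> e / 3) sequentially"
      using near[OF e3] by (intro eventually_sequentially_Suc[THEN iffD2]) (auto elim: eventually_mono)
    with a_close[OF e3]
    show "eventually (\<lambda>n. dist (b (Suc n)) y < e) sequentially"
    proof eventually_elim
      case (elim n)
      then show ?case using b_bound[of _ n "e / 3"] by (fastforce simp: dist_norm)
    qed
  qed
  ultimately show ?thesis by (simp add: filterlim_sequentially_Suc)
qed

end
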